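(* Let $B\subseteq\mathbb{R}^n$, $x^*\in B$, let $f$ be differentiable on a neighbourhood of $B$, let $w\in\mathbb{R}^n_{>0}$ be fixed and let $\beta=1/2$. Put $$C_w(B,x^* )=\{c\in\mathbb{R}^n:\ \exists r>0,\ x^*\in\mathcal{B}(c,rw)\subseteq B\}.$$ The following are equivalent: (1) for every admissible initial box, i.e. every $c_0\in\mathbb{R}^n$ and $r_0>0$ with $x^*\in\mathcal{B}(c_0,r_0w)\subseteq B$, and for every tie rule, the centres $c_k$ generated by Cube-Sign$(1/2,w)$ converge to $x^*$; (2) for every $c\in C_w(B,x^* )$ and every $i$ with $c_i\ne x_i^*$, one has $\partial_if(c)(c_i-x_i^* )>0$. In that case $M_k\le 2^{-k}r_0$ for all $k$, for every admissible initial box and every tie rule. For $B=\mathbb{R}^n$, condition (2) is exactly $f\in\mathcal{U}(x^*,\mathbb{R}^n)$.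
   Context: For $c\in\mathbb{R}^n$ and $r\in\mathbb{R}^n_{>0}$, $\mathcal{B}(c,r)=\{x:|x_i-c_i|\le r_i,\ i=1,\dots,n\}$. $\|u\|_{\infty,w}=\max_i|u_i|/w_i$; products $\odot$ are componentwise. Algorithm Cube-Sign$(\beta,w)$: from $c_0$, $r_0>0$, put $R_k=\beta^kr_0$. At step $k$ take $s_k\in\{-1,+1\}^n$ with $s_{k,i}=\operatorname{sign}\partial_if(c_k)$ whenever $\partial_if(c_k)\ne0$; if $\partial_if(c_k)=0$, $s_{k,i}\in\{-1,+1\}$ is chosen by a tie rule (any rule depending only on query points, sign answers and previous choices). Then $c_{k+1}=c_k-(1-\beta)R_k\,w\odot s_k$. $M_k=\|c_k-x^*\|_{\infty,w}$. Class $\mathcal{U}(x^*,B)$: differentiable $f$ such that $\partial_if(x)(x_i-x_i^* )>0$ for every $x\in B$ and every $i$ with $x_i\ne x_i^*$. *)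

theory Defs
  imports "HOL-Analysis.Analysis"
begin

definition box_around :: "real ^ 'n \<Rightarrow> real ^ 'n \<Rightarrow> (real ^ 'n) set" where
  "box_around c r = {x. \<forall>i. \<bar>x $ i - c $ i\<bar> \<le> r $ i}"

definition weighted_sup_norm :: "real ^ 'n \<Rightarrow> real ^ 'n \<Rightarrow> real" where
  "weighted_sup_norm w u = Max (range (\<lambda>i. \<bar>u $ i\<bar> / w $ i))"

definition partial_deriv :: "(real ^ 'n \<Rightarrow> real) \<Rightarrow> 'n \<Rightarrow> real ^ 'n \<Rightarrow> real" where
  "partial_deriv f i x = deriv (\<lambda>t. f (x + t *\<^sub>R axis i 1)) 0"

text \<open>
  Functions are total here, so a function given only near \<open>B\<close> is represented by an arbitrary
  extension; only its restriction to a neighbourhood of \<open>B\<close> is constrained.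
\<close>

definition differentiable_near :: "(real ^ 'n \<Rightarrow> real) \<Rightarrow> (real ^ 'n) set \<Rightarrow> bool" where
  "differentiable_near f B \<longleftrightarrow> (\<exists>U. open U \<and> B \<subseteq> U \<and> f differentiable_on U)"

text \<open>
  A record of one step of the algorithm is the triple of the query point, the vector of the signs
  of the partial derivatives there (with entry 0 where the partial derivative vanishes), and the
  choice \<open>s\<^sub>k\<close>. A tie rule sees the records of all earlier steps, oldest first, the current query
  point and the current signs. It proposes a vector of entries \<open>\<plusminus>1\<close>, of which only the entries at
  vanishing partial derivatives are used.
\<close>

type_synonym 'n step_record = "(real ^ 'n) \<times> (real ^ 'n) \<times> (real ^ 'n)"

type_synonym 'n tie_rule = "'n step_record list \<Rightarrow> real ^ 'n \<Rightarrow> real ^ 'n \<Rightarrow> real ^ 'n"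

definition is_tie_rule :: "('n::finite) tie_rule \<Rightarrow> bool" where
  "is_tie_rule \<tau> \<longleftrightarrow> (\<forall>h c g i. \<tau> h c g $ i \<in> {- 1, 1})"

definition sign_answer :: "(real ^ 'n \<Rightarrow> real) \<Rightarrow> real ^ 'n \<Rightarrow> real ^ 'n" where
  "sign_answer f c = (\<chi> i. sgn (partial_deriv f i c))"

definition step_choice ::
  "(real ^ 'n \<Rightarrow> real) \<Rightarrow> ('n::finite) tie_rule \<Rightarrow> 'n step_record list \<Rightarrow> real ^ 'n \<Rightarrow> real ^ 'n" where
  "step_choice f \<tau> h c =
     (\<chi> i. if partial_deriv f i c \<noteq> 0 then sgn (partial_deriv f i c)
           else \<tau> h c (sign_answer f c) $ i)"

text \<open>
  The state before step \<open>k\<close> consists of the records of the steps \<open>0, \<dots>, k - 1\<close> and the centre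
  \<open>c\<^sub>k\<close>. The product \<open>w * s\<close> of vectors is componentwise.
\<close>

primrec cube_sign_state ::
  "real \<Rightarrow> real ^ 'n \<Rightarrow> (real ^ 'n \<Rightarrow> real) \<Rightarrow> ('n::finite) tie_rule \<Rightarrow> real ^ 'n \<Rightarrow> real
     \<Rightarrow> nat \<Rightarrow> 'n step_record list \<times> (real ^ 'n)" where
  "cube_sign_state \<beta> w f \<tau> c0 r0 0 = ([], c0)"
| "cube_sign_state \<beta> w f \<tau> c0 r0 (Suc k) =
     (let (h, c) = cube_sign_state \<beta> w f \<tau> c0 r0 k;
          s = step_choice f \<tau> h c
      in (h @ [(c, sign_answer f c, s)],
          c - ((1 - \<beta>) * (\<beta> ^ k * r0)) *\<^sub>R (w * s)))"

definition cube_sign ::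
  "real \<Rightarrow> real ^ 'n \<Rightarrow> (real ^ 'n \<Rightarrow> real) \<Rightarrow> ('n::finite) tie_rule \<Rightarrow> real ^ 'n \<Rightarrow> real
     \<Rightarrow> nat \<Rightarrow> real ^ 'n" where
  "cube_sign \<beta> w f \<tau> c0 r0 k = snd (cube_sign_state \<beta> w f \<tau> c0 r0 k)"

definition admissible_box ::
  "real ^ 'n \<Rightarrow> (real ^ 'n) set \<Rightarrow> real ^ 'n \<Rightarrow> real ^ 'n \<Rightarrow> real \<Rightarrow> bool" where
  "admissible_box w B xs c r \<longleftrightarrow>
     r > 0 \<and> xs \<in> box_around c (r *\<^sub>R w) \<and> box_around c (r *\<^sub>R w) \<subseteq> B"

definition admissible_centres ::
  "real ^ 'n \<Rightarrow> (real ^ 'n) set \<Rightarrow> real ^ 'n \<Rightarrow> (real ^ 'n) set" where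
  "admissible_centres w B xs = {c. \<exists>r. admissible_box w B xs c r}"

definition class_U :: "real ^ 'n \<Rightarrow> (real ^ 'n) set \<Rightarrow> (real ^ 'n \<Rightarrow> real) set" where
  "class_U xs B =
     {f. differentiable_near f B \<and>
         (\<forall>x\<in>B. \<forall>i. x $ i \<noteq> xs $ i \<longrightarrow> partial_deriv f i x * (x $ i - xs $ i) > 0)}"

definition cube_sign_converges ::
  "real \<Rightarrow> real ^ 'n \<Rightarrow> (real ^ 'n) set \<Rightarrow> real ^ 'n \<Rightarrow> (real ^ 'n \<Rightarrow> real) \<Rightarrow> bool" where
  "cube_sign_converges \<beta> w B xs f \<longleftrightarrow>
     (\<forall>c0 r0 \<tau>. admissible_box w B xs c0 r0 \<longrightarrow> is_tie_rule \<tau> \<longrightarrow>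
        cube_sign \<beta> w f \<tau> c0 r0 \<longlonglongrightarrow> xs)"

definition centre_sign_condition ::
  "real ^ 'n \<Rightarrow> (real ^ 'n) set \<Rightarrow> real ^ 'n \<Rightarrow> (real ^ 'n \<Rightarrow> real) \<Rightarrow> bool" where
  "centre_sign_condition w B xs f \<longleftrightarrow>
     (\<forall>c\<in>admissible_centres w B xs. \<forall>i. c $ i \<noteq> xs $ i \<longrightarrow>
        partial_deriv f i c * (c $ i - xs $ i) > 0)"

end

theory Submission
  imports Defs
begin

text \<open>
  Every entry of a choice is \<open>\<plusminus>1\<close>, so coordinate \<open>i\<close> moves by exactly \<open>(1 - \<beta>) R\<^sub>k w\<^sub>i\<close> in step \<open>k\<close>,
  whatever \<open>f\<close> is. As \<open>R\<^sub>k - R\<^bsub>k+1\<^esub> = (1 - \<beta>) R\<^sub>k\<close>, these lengths telescope: from step \<open>m\<close> on the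
  coordinate travels at most \<open>R\<^sub>m w\<^sub>i\<close> altogether (\<open>cube_sign_displacement\<close>). Both directions rest
  on this budget.

  If the sign condition holds, the invariant is that the box of radius \<open>R\<^sub>k w\<close> about \<open>c\<^sub>k\<close> contains
  the target. By the budget this box lies in the initial one, hence in \<open>B\<close>; so \<open>c\<^sub>k\<close> is itself an
  admissible centre, the condition applies there, and each coordinate off the target moves towards
  it. A distance in \<open>[0, R\<^sub>k w\<^sub>i]\<close> becomes a signed distance in
  \<open>[- (1 - \<beta>) R\<^sub>k w\<^sub>i, \<beta> R\<^sub>k w\<^sub>i]\<close>, which is within the new radius when \<open>\<beta> \<ge> 1/2\<close>. The invariant is the
  rate \<open>M\<^sub>k \<le> R\<^sub>k\<close>, and convergence follows (\<open>centre_sign_condition_imp_mem_box\<close>).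

  If the condition fails in coordinate \<open>i\<close> at an admissible centre, start there with a tie rule that
  moves coordinate \<open>i\<close> away from the target. The first step adds \<open>(1 - \<beta>) r\<^sub>0 w\<^sub>i\<close> to a positive
  distance, and the remaining budget is at most \<open>\<beta> r\<^sub>0 w\<^sub>i\<close>. For \<open>\<beta> \<le> 1/2\<close> the error is never undone
  (\<open>cube_sign_converges_imp_centre_sign_condition\<close>). The value \<open>\<beta> = 1/2\<close> is the only one at which
  both arguments work.
\<close>

section \<open>Step lengths and the movement budget\<close>

definition cube_sign_choice ::
  "real \<Rightarrow> real ^ 'n \<Rightarrow> (real ^ 'n \<Rightarrow> real) \<Rightarrow> ('n::finite) tie_rule \<Rightarrow> real ^ 'n \<Rightarrow> real
     \<Rightarrow> nat \<Rightarrow> real ^ 'n" where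
  "cube_sign_choice \<beta> w f \<tau> c0 r0 k =
     step_choice f \<tau> (fst (cube_sign_state \<beta> w f \<tau> c0 r0 k)) (cube_sign \<beta> w f \<tau> c0 r0 k)"

lemma cube_sign_0 [simp]: "cube_sign \<beta> w f \<tau> c0 r0 0 = c0"
  by (simp add: cube_sign_def)

lemma cube_sign_Suc_nth:
  "cube_sign \<beta> w f \<tau> c0 r0 (Suc k) $ i = cube_sign \<beta> w f \<tau> c0 r0 k $ i
     - (1 - \<beta>) * (\<beta> ^ k * r0) * w $ i * cube_sign_choice \<beta> w f \<tau> c0 r0 k $ i"
  by (simp add: cube_sign_def cube_sign_choice_def Let_def split_beta)

lemma abs_step_choice:
  assumes "is_tie_rule \<tau>"
  shows "\<bar>step_choice f \<tau> h c $ i\<bar> = 1"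
proof -
  have "\<tau> h c (sign_answer f c) $ i \<in> {- 1, 1}"
    using assms by (simp add: is_tie_rule_def)
  then show ?thesis
    by (auto simp: step_choice_def sgn_if)
qed

lemma step_choice_eq_sgn:
  assumes "partial_deriv f i c * d > 0"
  shows "step_choice f \<tau> h c $ i = sgn d"
  using assms by (auto simp: step_choice_def sgn_if zero_less_mult_iff)

text \<open>
  The step lengths \<open>(1 - \<beta>) R\<^sub>k w\<^sub>i = (R\<^sub>k - R\<^bsub>k+1\<^esub>) w\<^sub>i\<close> telescope.
\<close>

lemma cube_sign_displacement:
  fixes f :: "real ^ 'n \<Rightarrow> real"
  assumes "is_tie_rule \<tau>" "0 \<le> \<beta>" "\<beta> \<le> 1" "0 \<le> r0" "0 \<le> w $ i"
  shows "\<bar>cube_sign \<beta> w f \<tau> c0 r0 (m + k) $ i - cube_sign \<beta> w f \<tau> c0 r0 m $ i\<bar>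
           \<le> (\<beta> ^ m - \<beta> ^ (m + k)) * r0 * w $ i"
proof (induction k)
  case 0
  then show ?case by simp
next
  case (Suc k)
  let ?c = "cube_sign \<beta> w f \<tau> c0 r0"
  have "\<bar>?c (Suc (m + k)) $ i - ?c (m + k) $ i\<bar> = (1 - \<beta>) * (\<beta> ^ (m + k) * r0) * w $ i"
    using assms by (simp add: cube_sign_Suc_nth cube_sign_choice_def abs_mult abs_step_choice)
  also have "\<dots> = (\<beta> ^ (m + k) - \<beta> ^ Suc (m + k)) * r0 * w $ i"
    by (simp add: algebra_simps)
  finally have "\<bar>?c (Suc (m + k)) $ i - ?c m $ i\<bar>
      \<le> (\<beta> ^ m - \<beta> ^ (m + k)) * r0 * w $ i + (\<beta> ^ (m + k) - \<beta> ^ Suc (m + k)) * r0 * w $ i"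
    using Suc.IH by linarith
  also have "\<dots> = (\<beta> ^ m - \<beta> ^ Suc (m + k)) * r0 * w $ i"
    by (simp add: algebra_simps)
  finally show ?case by simp
qed

text \<open>
  By step \<open>k\<close> the centre has moved by at most \<open>(r\<^sub>0 - R\<^sub>k) w\<^sub>i\<close>, and the half-width \<open>R\<^sub>k w\<^sub>i\<close> of the box
  has shrunk by just this amount.
\<close>

lemma box_around_cube_sign_subset:
  fixes f :: "real ^ 'n \<Rightarrow> real"
  assumes "is_tie_rule \<tau>" "0 \<le> \<beta>" "\<beta> \<le> 1" "0 \<le> r0" "\<And>i. 0 \<le> w $ i"
  shows "box_around (cube_sign \<beta> w f \<tau> c0 r0 k) ((\<beta> ^ k * r0) *\<^sub>R w) \<subseteq> box_around c0 (r0 *\<^sub>R w)"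
proof
  fix x assume x: "x \<in> box_around (cube_sign \<beta> w f \<tau> c0 r0 k) ((\<beta> ^ k * r0) *\<^sub>R w)"
  have "\<bar>x $ i - c0 $ i\<bar> \<le> r0 * w $ i" for i
  proof -
    have "\<bar>cube_sign \<beta> w f \<tau> c0 r0 k $ i - c0 $ i\<bar> \<le> r0 * w $ i - \<beta> ^ k * r0 * w $ i"
      using cube_sign_displacement[of \<tau> \<beta> r0 w i f c0 0 k] assms by (simp add: algebra_simps)
    moreover have "\<bar>x $ i - cube_sign \<beta> w f \<tau> c0 r0 k $ i\<bar> \<le> \<beta> ^ k * r0 * w $ i"
      using x by (simp add: box_around_def)
    ultimately show ?thesis by linarith
  qed
  then show "x \<in> box_around c0 (r0 *\<^sub>R w)"
    by (simp add: box_around_def)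
qed

section \<open>Sufficiency of the sign condition\<close>

text \<open>
  Overshooting is the only danger, and it is harmless: a coordinate passes the target by at most one
  step length \<open>(1 - \<beta>) R\<close>, which is within the new radius \<open>\<beta> R\<close>. At \<open>d = 0\<close> the direction is
  arbitrary, and the same bound covers it.
\<close>

lemma abs_contracting_step_le:
  fixes d R s \<beta> :: real
  assumes "1/2 \<le> \<beta>" "\<beta> \<le> 1" "\<bar>d\<bar> \<le> R" "\<bar>s\<bar> = 1" "d \<noteq> 0 \<Longrightarrow> s = sgn d"
  shows "\<bar>d - (1 - \<beta>) * R * s\<bar> \<le> \<beta> * R"
proof -
  have "R \<ge> 0" using assms(3) by linarith
  have "0 \<le> (1 - \<beta>) * R" "(1 - \<beta>) * R \<le> \<beta> * R"
    using \<open>R \<ge> 0\<close> assms(1,2) by (auto intro: mult_right_mono)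
  moreover have "(1 - \<beta>) * R + \<beta> * R = R"
    by (simp add: algebra_simps)
  moreover have "s = 1 \<and> d \<ge> 0 \<or> s = - 1 \<and> d \<le> 0"
    using assms(4,5) by (cases "d = 0") (auto simp: sgn_if abs_if split: if_splits)
  ultimately show ?thesis
    using assms(3) by auto
qed

lemma centre_sign_condition_imp_mem_box:
  fixes f :: "real ^ 'n \<Rightarrow> real"
  assumes cond: "centre_sign_condition w B xs f"
    and adm: "admissible_box w B xs c0 r0" and tie: "is_tie_rule \<tau>"
    and w: "\<And>i. w $ i > 0" and \<beta>: "1/2 \<le> \<beta>" "\<beta> \<le> 1"
  shows "xs \<in> box_around (cube_sign \<beta> w f \<tau> c0 r0 k) ((\<beta> ^ k * r0) *\<^sub>R w)"
proof (induction k)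
  case 0
  then show ?case
    using adm by (simp add: admissible_box_def)
next
  case (Suc k)
  let ?c = "cube_sign \<beta> w f \<tau> c0 r0" and ?s = "cube_sign_choice \<beta> w f \<tau> c0 r0 k"
  have r0: "r0 > 0" using adm by (simp add: admissible_box_def)
  have "box_around (?c k) ((\<beta> ^ k * r0) *\<^sub>R w) \<subseteq> box_around c0 (r0 *\<^sub>R w)"
    using tie \<beta> r0 w by (intro box_around_cube_sign_subset) (auto simp: less_imp_le)
  then have "admissible_box w B xs (?c k) (\<beta> ^ k * r0)"
    using Suc.IH adm r0 \<beta> by (auto simp: admissible_box_def)
  then have centre: "?c k \<in> admissible_centres w B xs"
    by (auto simp: admissible_centres_def)
  have "\<bar>xs $ i - ?c (Suc k) $ i\<bar> \<le> \<beta> ^ Suc k * r0 * w $ i" for i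
  proof -
    let ?d = "?c k $ i - xs $ i" and ?R = "\<beta> ^ k * r0 * w $ i"
    have "\<bar>?d\<bar> \<le> ?R"
      using Suc.IH by (simp add: box_around_def abs_minus_commute)
    moreover have "\<bar>?s $ i\<bar> = 1"
      using tie by (simp add: cube_sign_choice_def abs_step_choice)
    moreover have "?s $ i = sgn ?d" if "?d \<noteq> 0"
    proof -
      have "partial_deriv f i (?c k) * ?d > 0"
        using cond centre that by (simp add: centre_sign_condition_def)
      then show ?thesis
        unfolding cube_sign_choice_def by (rule step_choice_eq_sgn)
    qed
    ultimately have "\<bar>?d - (1 - \<beta>) * ?R * ?s $ i\<bar> \<le> \<beta> * ?R"
      by (intro abs_contracting_step_le \<beta>)
    moreover have "xs $ i - ?c (Suc k) $ i = - (?d - (1 - \<beta>) * ?R * ?s $ i)"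
      by (simp add: cube_sign_Suc_nth algebra_simps)
    ultimately show ?thesis by (simp add: mult.assoc)
  qed
  then show ?case by (simp add: box_around_def)
qed

lemma mem_box_iff_weighted_sup_norm_le:
  fixes w c x :: "real ^ 'n"
  assumes "\<And>i. w $ i > 0"
  shows "x \<in> box_around c (r *\<^sub>R w) \<longleftrightarrow> weighted_sup_norm w (c - x) \<le> r"
  using assms
  by (auto simp: box_around_def weighted_sup_norm_def pos_divide_le_eq abs_minus_commute)

lemma centre_sign_condition_imp_cube_sign_converges:
  fixes f :: "real ^ 'n \<Rightarrow> real"
  assumes "centre_sign_condition w B xs f" "\<And>i. w $ i > 0" "1/2 \<le> \<beta>" "\<beta> < 1"
  shows "cube_sign_converges \<beta> w B xs f"
  unfolding cube_sign_converges_def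
proof (intro allI impI)
  fix c0 r0 and \<tau> :: "'n tie_rule"
  assume *: "admissible_box w B xs c0 r0" "is_tie_rule \<tau>"
  let ?c = "cube_sign \<beta> w f \<tau> c0 r0"
  show "?c \<longlonglongrightarrow> xs"
  proof (rule vec_tendstoI)
    fix i
    have "\<bar>xs $ i - ?c k $ i\<bar> \<le> \<beta> ^ k * r0 * w $ i" for k
      using centre_sign_condition_imp_mem_box[OF assms(1) * assms(2,3), of k] assms(4)
      by (simp add: box_around_def)
    then have "\<forall>\<^sub>F k in sequentially. norm (?c k $ i - xs $ i) \<le> \<beta> ^ k * r0 * w $ i"
      by (simp add: abs_minus_commute)
    moreover have "(\<lambda>k. \<beta> ^ k * r0 * w $ i) \<longlonglongrightarrow> 0"
      using assms(3,4) by (intro tendsto_mult_left_zero LIMSEQ_power_zero) auto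
    ultimately have "(\<lambda>k. ?c k $ i - xs $ i) \<longlonglongrightarrow> 0"
      by (rule Lim_null_comparison)
    then show "(\<lambda>k. ?c k $ i) \<longlonglongrightarrow> xs $ i"
      by (rule LIM_zero_cancel)
  qed
qed

section \<open>Necessity of the sign condition\<close>

text \<open>
  One wrong first step cannot be repaired: it costs at least half of the initial radius, and the
  later steps together are worth at most the other half. So the distance to the target in the
  offending coordinate never falls below its initial value, which is positive.
\<close>

lemma cube_sign_converges_imp_centre_sign_condition:
  fixes f :: "real ^ 'n \<Rightarrow> real"
  assumes conv: "cube_sign_converges \<beta> w B xs f"
    and w: "\<And>i. w $ i > 0" and \<beta>: "0 \<le> \<beta>" "\<beta> \<le> 1/2"
  shows "centre_sign_condition w B xs f"
  unfolding centre_sign_condition_def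
proof (intro ballI allI impI)
  fix c i
  assume "c \<in> admissible_centres w B xs" and ne: "c $ i \<noteq> xs $ i"
  then obtain r where adm: "admissible_box w B xs c r"
    by (auto simp: admissible_centres_def)
  then have r: "r > 0" by (simp add: admissible_box_def)
  let ?d = "c $ i - xs $ i"
  show "partial_deriv f i c * ?d > 0"
  proof (rule ccontr)
    assume wrong: "\<not> partial_deriv f i c * ?d > 0"
    \<comment> \<open>Steps are subtracted, so the sign opposite to that of \<open>c\<^sub>i - x\<^sup>*\<^sub>i\<close> leads away from the target.\<close>
    define \<tau> :: "'n tie_rule" where "\<tau> = (\<lambda>h c g. \<chi> j. - sgn ?d)"
    have tie: "is_tie_rule \<tau>"
      using ne by (auto simp: is_tie_rule_def \<tau>_def sgn_if)
    let ?c = "cube_sign \<beta> w f \<tau> c r"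
    let ?a = "(1 - \<beta>) * r * w $ i"
    have s: "cube_sign_choice \<beta> w f \<tau> c r 0 $ i = - sgn ?d"
      using wrong ne
      by (auto simp: cube_sign_choice_def step_choice_def \<tau>_def sgn_if zero_less_mult_iff)
    have "?c 1 $ i - xs $ i = ?d + ?a * sgn ?d"
      using cube_sign_Suc_nth[of \<beta> w f \<tau> c r 0 i] by (simp add: s algebra_simps)
    moreover have "?a \<ge> 0"
      using \<beta> r w[of i] by simp
    ultimately have first: "\<bar>?c 1 $ i - xs $ i\<bar> = \<bar>?d\<bar> + ?a"
      using ne by (auto simp: sgn_if)
    have far: "\<bar>?d\<bar> \<le> \<bar>?c (1 + k) $ i - xs $ i\<bar>" for k
    proof -
      have "\<bar>?c (1 + k) $ i - ?c 1 $ i\<bar> \<le> (\<beta> ^ 1 - \<beta> ^ (1 + k)) * r * w $ i"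
        using tie \<beta> r w[of i] by (intro cube_sign_displacement) auto
      also have "\<dots> \<le> (1 - \<beta>) * r * w $ i"
      proof -
        have "\<beta> ^ (1 + k) \<ge> 0" using \<beta> by simp
        then have "\<beta> ^ 1 - \<beta> ^ (1 + k) \<le> 1 - \<beta>"
          using \<beta> unfolding power_one_right by linarith
        then show ?thesis using r w[of i] by (intro mult_right_mono) auto
      qed
      finally show ?thesis using first by linarith
    qed
    have "?c \<longlonglongrightarrow> xs"
      using conv adm tie by (simp add: cube_sign_converges_def)
    then have "(\<lambda>k. ?c (k + 1)) \<longlonglongrightarrow> xs"
      by (rule LIMSEQ_ignore_initial_segment)
    then have "(\<lambda>k. \<bar>?c (k + 1) $ i - xs $ i\<bar>) \<longlonglongrightarrow> \<bar>xs $ i - xs $ i\<bar>"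
      by (intro tendsto_intros)
    then have "\<bar>?d\<bar> \<le> \<bar>xs $ i - xs $ i\<bar>"
      by (rule LIMSEQ_le_const) (use far in \<open>auto simp: add.commute\<close>)
    then show False using ne by simp
  qed
qed

section \<open>The whole space and the equivalence\<close>

text \<open>
  With no constraint from \<open>B\<close>, a box about any centre reaches the target once its radius is at least the
  weighted distance.
\<close>

lemma admissible_centres_UNIV:
  fixes w xs :: "real ^ 'n"
  assumes "\<And>i. w $ i > 0"
  shows "admissible_centres w UNIV xs = UNIV"
proof -
  have "admissible_box w UNIV xs c (max 1 (weighted_sup_norm w (c - xs)))" for c
    using mem_box_iff_weighted_sup_norm_le[OF assms] by (simp add: admissible_box_def)
  then show ?thesis by (auto simp: admissible_centres_def)
qed

theorem theorem2p7:
  fixes B :: "(real ^ 'n) set" and xs w :: "real ^ 'n" and f :: "real ^ 'n \<Rightarrow> real"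
  assumes "xs \<in> B"
    and "differentiable_near f B"
    and "\<And>i. w $ i > 0"
  shows "(cube_sign_converges (1/2) w B xs f \<longleftrightarrow> centre_sign_condition w B xs f)
    \<and> (cube_sign_converges (1/2) w B xs f \<longrightarrow>
        (\<forall>c0 r0 \<tau> k. admissible_box w B xs c0 r0 \<longrightarrow> is_tie_rule \<tau> \<longrightarrow>
           weighted_sup_norm w (cube_sign (1/2) w f \<tau> c0 r0 k - xs) \<le> (1/2) ^ k * r0))
    \<and> (B = UNIV \<longrightarrow> (centre_sign_condition w B xs f \<longleftrightarrow> f \<in> class_U xs UNIV))"
proof (intro conjI impI allI)
  show equiv: "cube_sign_converges (1/2) w B xs f \<longleftrightarrow> centre_sign_condition w B xs f"
    using cube_sign_converges_imp_centre_sign_condition[of "1/2" w B xs f]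
      centre_sign_condition_imp_cube_sign_converges[of w B xs f "1/2"] assms(3)
    by auto
  show "weighted_sup_norm w (cube_sign (1/2) w f \<tau> c0 r0 k - xs) \<le> (1/2) ^ k * r0"
    if "cube_sign_converges (1/2) w B xs f" "admissible_box w B xs c0 r0" "is_tie_rule \<tau>"
    for c0 r0 k and \<tau> :: "'n tie_rule"
    using centre_sign_condition_imp_mem_box[of w B xs f c0 r0 \<tau> "1/2" k] that equiv assms(3)
    by (simp add: mem_box_iff_weighted_sup_norm_le)
  show "centre_sign_condition w B xs f \<longleftrightarrow> f \<in> class_U xs UNIV" if "B = UNIV"
    using assms(2) that admissible_centres_UNIV[OF assms(3)]
    by (simp add: centre_sign_condition_def class_U_def)
qed

end
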